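(* Let $D$ be the generator of a strongly continuous one-parameter group of isometries $e^{tD}$, $t\in\mathbb{R}$, in a complex Banach space $E$, and let $\sigma>0$. For every $f\in\mathbf{B}_\sigma(D)$ and all $z\in\mathbb{C}$, $$e^{zD}f=z\,\mathrm{sinc}\Big(\frac{\sigma z}{\pi}\Big)Df+\mathrm{sinc}\Big(\frac{\sigma z}{\pi}\Big)f+\sum_{k\in\mathbb{Z}\setminus\{0\}}\frac{\sigma z}{k\pi}\,\mathrm{sinc}\Big(\frac{\sigma z}{\pi}-k\Big)e^{\frac{k\pi}{\sigma}D}f,$$ where the series converges in the norm of $E$.
   Context: $\mathcal{D}^\infty$ is the intersection of the domains of all powers $D^k$, $k\in\mathbb{N}$. $\mathbf{B}_\sigma(D)$ is the set of all $f\in\mathcal{D}^\infty$ such that $\|D^kf\|\le\sigma^k\|f\|$ for all $k\in\mathbb{N}=\{1,2,\dots\}$. For $f\in\mathbf{B}_\sigma(D)$ and $z\in\mathbb{C}$, $e^{zD}f=\sum_{k\ge0}z^kD^kf/k!$. $\mathrm{sinc}(z)=\frac{\sin\pi z}{\pi z}$ for $z\ne0$, $\mathrm{sinc}(0)=1$. *)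

theory Defs
  imports "HOL-Analysis.Analysis"
begin

text \<open>Complex Banach spaces, layered on top of the real type classes of HOL-Analysis, so that
  norm, limits and series of the underlying real space are the ones of the complex space.\<close>

class scaleC = scaleR +
  fixes scaleC :: "complex \<Rightarrow> 'a \<Rightarrow> 'a"  (infixr "*\<^sub>C" 75)
  assumes scaleR_scaleC: "scaleR r = scaleC (complex_of_real r)"

class complex_vector = scaleC + ab_group_add +
  assumes scaleC_add_right: "a *\<^sub>C (x + y) = a *\<^sub>C x + a *\<^sub>C y"
    and scaleC_add_left: "(a + b) *\<^sub>C x = a *\<^sub>C x + b *\<^sub>C x"
    and scaleC_scaleC: "a *\<^sub>C (b *\<^sub>C x) = (a * b) *\<^sub>C x"
    and scaleC_one: "1 *\<^sub>C x = x"

class complex_normed_vector = complex_vector + real_normed_vector +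
  assumes norm_scaleC: "norm (a *\<^sub>C x) = cmod a * norm x"

class complex_banach = complex_normed_vector + complete_space

subclass (in complex_banach) banach ..

instantiation complex :: complex_banach
begin

definition scaleC_complex :: "complex \<Rightarrow> complex \<Rightarrow> complex"
  where "scaleC_complex a x = a * x"

instance
  by standard
    (auto simp: scaleC_complex_def fun_eq_iff scaleR_conv_of_real algebra_simps norm_mult)

end

definition isometry_group :: "(real \<Rightarrow> 'a::complex_banach \<Rightarrow> 'a) \<Rightarrow> bool"
  where "isometry_group T \<longleftrightarrow>
    (\<forall>t. Vector_Spaces.linear (*\<^sub>C) (*\<^sub>C) (T t)) \<and>
    (\<forall>t f. norm (T t f) = norm f) \<and>
    (\<forall>f. T 0 f = f) \<and>
    (\<forall>s t f. T (s + t) f = T s (T t f)) \<and>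
    (\<forall>f. continuous_on UNIV (\<lambda>t. T t f))"

text \<open>The generator is an unbounded operator, represented by its domain together with a total
  function whose values outside the domain are irrelevant.\<close>

definition generator_domain :: "(real \<Rightarrow> 'a::complex_banach \<Rightarrow> 'a) \<Rightarrow> 'a set"
  where "generator_domain T = {f. \<exists>g. ((\<lambda>t. (T t f - f) /\<^sub>R t) \<longlongrightarrow> g) (at 0)}"

definition generator :: "(real \<Rightarrow> 'a::complex_banach \<Rightarrow> 'a) \<Rightarrow> 'a \<Rightarrow> 'a"
  where "generator T f = Lim (at 0) (\<lambda>t. (T t f - f) /\<^sub>R t)"

text \<open>In the following, \<open>A\<close> is the domain of the operator \<open>D\<close>.\<close>

primrec power_domain :: "'a set \<Rightarrow> ('a \<Rightarrow> 'a) \<Rightarrow> nat \<Rightarrow> 'a set"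
  where
    "power_domain A D 0 = UNIV"
  | "power_domain A D (Suc k) = {f \<in> power_domain A D k. (D ^^ k) f \<in> A}"

definition smooth_domain :: "'a set \<Rightarrow> ('a \<Rightarrow> 'a) \<Rightarrow> 'a set"
  where "smooth_domain A D = (\<Inter>k. power_domain A D k)"

definition bernstein_space :: "'a::complex_banach set \<Rightarrow> ('a \<Rightarrow> 'a) \<Rightarrow> real \<Rightarrow> 'a set"
  where "bernstein_space A D \<sigma> =
    {f \<in> smooth_domain A D. \<forall>k\<ge>1. norm ((D ^^ k) f) \<le> \<sigma> ^ k * norm f}"

definition exp_operator :: "('a::complex_banach \<Rightarrow> 'a) \<Rightarrow> complex \<Rightarrow> 'a \<Rightarrow> 'a"
  where "exp_operator D z f = (\<Sum>k. (z ^ k / fact k) *\<^sub>C (D ^^ k) f)"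

lemma summable_exp_operator:
  assumes "f \<in> bernstein_space A D \<sigma>"
  shows "summable (\<lambda>k. (z ^ k / fact k) *\<^sub>C (D ^^ k) f)"
proof (rule summable_comparison_test'[where N = 1])
  show "summable (\<lambda>k. ((cmod z * \<sigma>) ^ k /\<^sub>R fact k) * norm f)"
    by (intro summable_mult2 summable_exp_generic)
next
  fix k :: nat
  assume "1 \<le> k"
  then have "norm ((D ^^ k) f) \<le> \<sigma> ^ k * norm f"
    using assms by (simp add: bernstein_space_def)
  then have "cmod z ^ k / fact k * norm ((D ^^ k) f) \<le> cmod z ^ k / fact k * (\<sigma> ^ k * norm f)"
    by (intro mult_left_mono) simp_all
  then show "norm ((z ^ k / fact k) *\<^sub>C (D ^^ k) f) \<le> ((cmod z * \<sigma>) ^ k /\<^sub>R fact k) * norm f"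
    by (simp add: norm_scaleC norm_divide norm_power power_mult_distrib field_simps)
qed

text \<open>The normalised cardinal sine of a complex argument.\<close>

definition csinc :: "complex \<Rightarrow> complex"
  where "csinc z = (if z = 0 then 1 else sin (of_real pi * z) / (of_real pi * z))"

end

theory Submission
  imports Defs "HOL-Complex_Analysis.Complex_Analysis" "HOL-Real_Asymp.Real_Asymp"
begin

text \<open>Rescale so that \<open>\<sigma> = 1\<close>, with \<open>\<alpha> n = D\<^sup>n f / \<sigma>\<^sup>n\<close>. Then \<open>g(w) = e\<^sup>w\<^sup>D f\<close> is an entire power series with
  coefficients in \<open>E\<close>, and since the group consists of isometries,
  \<open>\<parallel>g(x + iy)\<parallel> = \<parallel>g(iy)\<parallel> \<le> exp \<bar>y\<bar> \<parallel>f\<parallel>\<close>. The function \<open>H(w) = (g(w) - sin w / w f) / w\<close> is again such a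
  power series, with \<open>H(0) = Df\<close> and \<open>\<parallel>H(w)\<parallel> = O(exp \<bar>Im w\<bar> / \<bar>w\<bar>)\<close>, so the integrals of
  \<open>H(w) / ((w - \<zeta>) sin w)\<close> over the squares with vertices \<open>(N + 1/2) \<pi> (\<plusminus> 1 \<plusminus> i)\<close> tend to 0. The
  residues at \<open>\<zeta>\<close> and at the multiples of \<open>\<pi>\<close> give the formula. No functionals are needed: the
  residue theorem is applied to each monomial of \<open>H\<close>, and the resulting identities are summed.\<close>

section \<open>Complex scalar multiplication and Taylor series of vector-valued curves\<close>

lemma bounded_bilinear_scaleC:
  "bounded_bilinear ((*\<^sub>C) :: complex \<Rightarrow> 'a \<Rightarrow> 'a::complex_normed_vector)"
proof
  fix r :: real and a :: complex and x :: 'a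
  show "(r *\<^sub>R a) *\<^sub>C x = r *\<^sub>R (a *\<^sub>C x)"
    by (simp add: scaleR_scaleC scaleC_scaleC scaleC_complex_def)
  show "a *\<^sub>C (r *\<^sub>R x) = r *\<^sub>R (a *\<^sub>C x)"
    by (simp add: scaleR_scaleC scaleC_scaleC mult.commute)
  show "\<exists>K. \<forall>(a::complex) (x::'a). norm (a *\<^sub>C x) \<le> norm a * norm x * K"
    by (rule exI[of _ 1]) (simp add: norm_scaleC)
qed (simp_all add: scaleC_add_left scaleC_add_right)

interpretation scaleC: bounded_bilinear "(*\<^sub>C) :: complex \<Rightarrow> 'a \<Rightarrow> 'a::complex_normed_vector"
  by (rule bounded_bilinear_scaleC)

lemma scaleC_of_real: "complex_of_real r *\<^sub>C x = r *\<^sub>R (x::'a::complex_vector)"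
  by (simp add: scaleR_scaleC)

text \<open>The Taylor remainder is an integral of norm at most M t^(n+1) / n!, because one constant
  bounds all derivatives, and this tends to 0.\<close>

lemma taylor_sums:
  fixes \<Phi> :: "nat \<Rightarrow> real \<Rightarrow> 'a::banach"
  assumes deriv: "\<And>k s. (\<Phi> k has_vector_derivative \<Phi> (Suc k) s) (at s)"
    and bound: "\<And>k s. norm (\<Phi> k s) \<le> M"
    and "0 \<le> t"
  shows "(\<lambda>n. (t ^ n / fact n) *\<^sub>R \<Phi> n 0) sums \<Phi> 0 t"
proof -
  have M: "0 \<le> M"
    using bound[of 0 0] norm_ge_zero by (rule order_trans[rotated])
  have *: "norm (\<Phi> 0 t - (\<Sum>i<Suc n. (t ^ i / fact i) *\<^sub>R \<Phi> i 0)) \<le> t ^ n /\<^sub>R fact n * (M * t)"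
    for n
  proof -
    have "((\<lambda>x. ((t - x) ^ (Suc n - 1) / fact (Suc n - 1)) *\<^sub>R \<Phi> (Suc n) x) has_integral
        \<Phi> 0 t - (\<Sum>i<Suc n. ((t - 0) ^ i / fact i) *\<^sub>R \<Phi> i 0)) {0..t}"
      by (rule Taylor_has_integral) (auto intro: deriv has_vector_derivative_at_within \<open>0 \<le> t\<close>)
    then have "norm (\<Phi> 0 t - (\<Sum>i<Suc n. ((t - 0) ^ i / fact i) *\<^sub>R \<Phi> i 0))
        \<le> (t ^ n / fact n * M) * measure lborel (cbox 0 t)"
      using M \<open>0 \<le> t\<close>
      by (intro has_integral_bound)
         (auto intro!: mult_mono divide_right_mono power_mono bound)
    then show ?thesis
      using \<open>0 \<le> t\<close> by (simp add: divide_inverse mult_ac)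
  qed
  have "(\<lambda>n. t ^ n /\<^sub>R fact n * (M * t)) \<longlonglongrightarrow> 0"
    by (intro tendsto_mult_left_zero summable_LIMSEQ_zero summable_exp_generic)
  then have "(\<lambda>n. \<Phi> 0 t - (\<Sum>i<Suc n. (t ^ i / fact i) *\<^sub>R \<Phi> i 0)) \<longlonglongrightarrow> 0"
    by (rule Lim_null_comparison[rotated]) (use * in auto)
  from tendsto_diff[OF tendsto_const[of "\<Phi> 0 t"] this]
  have "(\<lambda>n. \<Sum>i<Suc n. (t ^ i / fact i) *\<^sub>R \<Phi> i 0) \<longlonglongrightarrow> \<Phi> 0 t"
    by (simp only: diff_diff_eq2 diff_0_right add_diff_cancel_left')
  then show ?thesis
    unfolding sums_def by (rule LIMSEQ_imp_Suc)
qed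

subsection \<open>Exponential series along the orbits of an isometry group\<close>

text \<open>Built on an arbitrary sequence instead of an operator, so that it also applies to
  rescaled and shifted coefficients and, in \<open>exp_series_add\<close>, to coefficients that are
  such series themselves.\<close>

definition exp_series :: "(nat \<Rightarrow> 'a::complex_banach) \<Rightarrow> complex \<Rightarrow> 'a"
  where "exp_series \<alpha> w = (\<Sum>n. (w ^ n / fact n) *\<^sub>C \<alpha> n)"

lemma norm_exp_series_term:
  "norm ((w ^ n / fact n) *\<^sub>C (x::'a::complex_normed_vector)) = norm w ^ n /\<^sub>R fact n * norm x"
  by (simp add: norm_scaleC norm_divide norm_power) (simp add: divide_inverse)

lemma abs_summable_exp_series:
  fixes \<alpha> :: "nat \<Rightarrow> 'a::complex_banach"
  assumes "\<And>n. norm (\<alpha> n) \<le> M"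
  shows "summable (\<lambda>n. norm ((w ^ n / fact n) *\<^sub>C \<alpha> n))"
proof (rule summable_comparison_test')
  show "summable (\<lambda>n. cmod w ^ n /\<^sub>R fact n * M)"
    by (intro summable_mult2 summable_exp_generic)
  show "norm (norm ((w ^ n / fact n) *\<^sub>C \<alpha> n)) \<le> cmod w ^ n /\<^sub>R fact n * M" for n
    unfolding norm_exp_series_term by (auto intro!: mult_left_mono assms)
qed

lemma exp_series_sums:
  assumes "\<And>n. norm (\<alpha> n) \<le> M"
  shows "(\<lambda>n. (w ^ n / fact n) *\<^sub>C \<alpha> n) sums exp_series \<alpha> w"
  unfolding exp_series_def
  by (rule summable_sums[OF summable_norm_cancel[OF abs_summable_exp_series[OF assms]]])

lemma norm_exp_series_le:
  assumes "\<And>n. norm (\<alpha> n) \<le> M"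
  shows "norm (exp_series \<alpha> w) \<le> exp (norm w) * M"
proof -
  have "(\<lambda>n. cmod w ^ n /\<^sub>R fact n * M) sums (exp (norm w) * M)"
    by (intro sums_mult2 exp_converges)
  moreover have "norm (exp_series \<alpha> w) \<le> (\<Sum>n. norm ((w ^ n / fact n) *\<^sub>C \<alpha> n))"
    unfolding exp_series_def by (intro summable_norm abs_summable_exp_series[OF assms])
  moreover have "(\<Sum>n. norm ((w ^ n / fact n) *\<^sub>C \<alpha> n)) \<le> (\<Sum>n. cmod w ^ n /\<^sub>R fact n * M)"
  proof (rule suminf_le)
    show "norm ((w ^ n / fact n) *\<^sub>C \<alpha> n) \<le> cmod w ^ n /\<^sub>R fact n * M" for n
      unfolding norm_exp_series_term by (auto intro!: mult_left_mono assms)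
  qed (intro abs_summable_exp_series[OF assms] summable_mult2 summable_exp_generic)+
  ultimately show ?thesis
    by (simp add: sums_iff)
qed

text \<open>The law e^{wD} e^{xD} = e^{(x+w)D}, with the index shift by \<open>k\<close> in the role
  of D^k. The double series converges absolutely, so it may be summed along antidiagonals, where the
  binomial theorem applies.\<close>

lemma exp_series_add:
  fixes \<alpha> :: "nat \<Rightarrow> 'a::complex_banach"
  assumes bound: "\<And>n. norm (\<alpha> n) \<le> M"
  shows "exp_series (\<lambda>k. exp_series (\<lambda>n. \<alpha> (n + k)) x) w = exp_series \<alpha> (x + w)"
proof -
  define F where "F = (\<lambda>(k, n). ((w ^ k / fact k) * (x ^ n / fact n)) *\<^sub>C \<alpha> (n + k))"
  have infsum_eq: "(\<Sum>\<^sub>\<infinity>n. (v ^ n / fact n) *\<^sub>C \<beta> n) = exp_series \<beta> v"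
    if "\<And>n. norm (\<beta> n) \<le> B" for \<beta> :: "nat \<Rightarrow> 'a" and v B
    by (intro infsumI norm_summable_imp_has_sum abs_summable_exp_series[OF that]
        exp_series_sums[OF that])
  have exp_has_sum: "((\<lambda>n. norm v ^ n / fact n) has_sum exp (norm v)) UNIV" for v :: complex
    using exp_converges[of "norm v"] by (intro sums_nonneg_imp_has_sum) (auto simp: divide_inverse_commute)
  have "(\<lambda>(k, n). (norm w ^ k / fact k) * (norm x ^ n / fact n)) summable_on UNIV \<times> UNIV"
    by (rule summable_on_SigmaI[where g = "\<lambda>k. (norm w ^ k / fact k) * exp (norm x)"])
       (simp_all only: prod.case, intro has_sum_cmult_right exp_has_sum,
        intro summable_on_cmult_left has_sum_imp_summable[OF exp_has_sum], simp)
  then have "(\<lambda>(k, n). (norm w ^ k / fact k) * (norm x ^ n / fact n) * M) summable_on UNIV \<times> UNIV"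
    unfolding case_prod_unfold by (rule summable_on_cmult_left)
  then have "(\<lambda>p. norm (F p)) summable_on UNIV \<times> UNIV"
    by (rule Infinite_Sum.abs_summable_on_comparison_test')
       (auto simp: F_def norm_scaleC norm_mult norm_divide norm_power
          intro!: divide_right_mono mult_left_mono bound)
  then have F: "F summable_on UNIV \<times> UNIV"
    by (rule abs_summable_summable)
  \<comment> \<open>For fixed \<open>m\<close>, the sum of both indices, all terms carry the same
    vector \<open>\<alpha> m\<close>, which leaves a scalar binomial sum.\<close>
  have bij: "bij_betw (\<lambda>(m, k). (k, m - k)) (SIGMA m:UNIV. {..m}) (UNIV \<times> (UNIV :: nat set))"
    by (rule bij_betwI[where g = "\<lambda>(k, n). (n + k, k)"]) auto
  have inner: "(\<Sum>\<^sub>\<infinity>k\<in>{..m}. F (k, m - k)) = ((x + w) ^ m / fact m) *\<^sub>C \<alpha> m" for m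
  proof -
    have "(\<Sum>\<^sub>\<infinity>k\<in>{..m}. F (k, m - k)) = (\<Sum>k\<le>m. (w ^ k / fact k) * (x ^ (m - k) / fact (m - k))) *\<^sub>C \<alpha> m"
      by (simp add: F_def scaleC.sum_left)
    also have "(\<Sum>k\<le>m. (w ^ k / fact k) * (x ^ (m - k) / fact (m - k))) = (w + x) ^ m / fact m"
      using exp_series_add_commuting[of w x m] by (simp add: scaleR_conv_of_real field_simps)
    finally show ?thesis
      by (simp add: add.commute)
  qed
  have "exp_series (\<lambda>k. exp_series (\<lambda>n. \<alpha> (n + k)) x) w
      = (\<Sum>\<^sub>\<infinity>k. (w ^ k / fact k) *\<^sub>C exp_series (\<lambda>n. \<alpha> (n + k)) x)"
    by (rule infsum_eq[symmetric, where B = "exp (norm x) * M"]) (intro norm_exp_series_le bound)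
  also have "\<dots> = (\<Sum>\<^sub>\<infinity>k. \<Sum>\<^sub>\<infinity>n. F (k, n))"
  proof (rule infsum_cong)
    fix k
    have "(\<lambda>n. (x ^ n / fact n) *\<^sub>C \<alpha> (n + k)) summable_on UNIV"
      by (rule norm_summable_imp_summable_on[OF abs_summable_exp_series[OF bound]])
    then have "(w ^ k / fact k) *\<^sub>C (\<Sum>\<^sub>\<infinity>n. (x ^ n / fact n) *\<^sub>C \<alpha> (n + k))
        = (\<Sum>\<^sub>\<infinity>n. (w ^ k / fact k) *\<^sub>C ((x ^ n / fact n) *\<^sub>C \<alpha> (n + k)))"
      by (intro infsumI[symmetric] has_sum_bounded_linear[OF scaleC.bounded_linear_right] has_sum_infsum)
    then show "(w ^ k / fact k) *\<^sub>C exp_series (\<lambda>n. \<alpha> (n + k)) x = (\<Sum>\<^sub>\<infinity>n. F (k, n))"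
      by (simp add: infsum_eq[OF bound] F_def scaleC_scaleC)
  qed
  also have "\<dots> = (\<Sum>\<^sub>\<infinity>p\<in>UNIV \<times> UNIV. F p)"
    by (rule infsum_Sigma_banach[OF F])
  also have "\<dots> = (\<Sum>\<^sub>\<infinity>p\<in>(SIGMA m:UNIV. {..m}). F (case p of (m, k) \<Rightarrow> (k, m - k)))"
    by (rule infsum_reindex_bij_betw[OF bij, symmetric])
  also have "\<dots> = (\<Sum>\<^sub>\<infinity>m. \<Sum>\<^sub>\<infinity>k\<in>{..m}. F (k, m - k))"
    using infsum_Sigma_banach[of "\<lambda>p. F (case p of (m, k) \<Rightarrow> (k, m - k))" UNIV "\<lambda>m. {..m}"]
      summable_on_reindex_bij_betw[OF bij, of F] F by simp
  also have "\<dots> = exp_series \<alpha> (x + w)"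
    by (simp add: inner infsum_eq[OF bound])
  finally show ?thesis .
qed

text \<open>The situation after rescaling: \<open>S t\<close> stands for e^{(t/\<sigma>)D} and
  \<open>\<alpha> n\<close> for D^n f / \<sigma>^n, so that the Bernstein inequality becomes one
  bound \<open>M\<close> for all coefficients.\<close>

locale isometric_orbit =
  fixes S :: "real \<Rightarrow> 'a::complex_banach \<Rightarrow> 'a" and \<alpha> :: "nat \<Rightarrow> 'a" and M :: real
  assumes linear: "Vector_Spaces.linear (*\<^sub>C) (*\<^sub>C) (S t)"
    and norm_S [simp]: "norm (S t x) = norm x"
    and S_0 [simp]: "S 0 x = x"
    and deriv: "((\<lambda>s. S s (\<alpha> k)) has_vector_derivative S s (\<alpha> (Suc k))) (at s)"
    and bound: "norm (\<alpha> n) \<le> M"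
begin

lemma S_scaleC: "S t (c *\<^sub>C x) = c *\<^sub>C S t x"
  using linear[of t] unfolding Vector_Spaces.linear_def module_hom_def module_hom_axioms_def by blast

lemma bounded_linear_S: "bounded_linear (S t)"
proof
  show "S t (x + y) = S t x + S t y" for x y
    using linear[of t] unfolding Vector_Spaces.linear_def module_hom_def module_hom_axioms_def by blast
  show "S t (r *\<^sub>R x) = r *\<^sub>R S t x" for r x
    using S_scaleC[of t "complex_of_real r" x] by (simp add: scaleC_of_real)
  show "\<exists>K. \<forall>x. norm (S t x) \<le> norm x * K"
    by (rule exI[of _ 1]) simp
qed

text \<open>This is the Taylor series at 0 of the orbit of \<open>\<alpha> k\<close>: its n-th
  derivative at \<open>s\<close> is \<open>S s (\<alpha> (n + k))\<close>, of norm at most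
  \<open>M\<close> since \<open>S s\<close> is isometric.\<close>

lemma S_eq_exp_series: "S t (\<alpha> k) = exp_series (\<lambda>n. \<alpha> (n + k)) (of_real t)"
proof -
  have eq: "(of_real t ^ n / fact n) *\<^sub>C x = (t ^ n / fact n) *\<^sub>R x" for n and x :: 'a
    using scaleC_of_real[of "t ^ n / fact n" x] by simp
  have "(\<lambda>n. (t ^ n / fact n) *\<^sub>R \<alpha> (n + k)) sums S t (\<alpha> k)"
  proof (cases "0 \<le> t")
    case True
    then show ?thesis
      using taylor_sums[of "\<lambda>n s. S s (\<alpha> (n + k))" M t] deriv bound by simp
  next
    case False
    \<comment> \<open>For negative \<open>t\<close> time is reversed, since
      \<open>taylor_sums\<close> expands to the right of 0. Every derivative costs a sign, and these
      signs cancel against those of the powers of \<open>- t\<close>.\<close>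
    have "((\<lambda>s. (-1) ^ n *\<^sub>R S (- s) (\<alpha> (n + k))) has_vector_derivative
        (-1) ^ Suc n *\<^sub>R S (- s) (\<alpha> (Suc n + k))) (at s)" for n s
    proof -
      have "((\<lambda>s. S (- s) (\<alpha> (n + k))) has_vector_derivative - S (- s) (\<alpha> (Suc n + k))) (at s)"
        using vector_diff_chain_at[OF has_vector_derivative_minus[OF has_vector_derivative_id]
            deriv[of "n + k" "- s"]]
        by (simp add: o_def)
      from bounded_linear.has_vector_derivative[OF bounded_linear_scaleR_right this]
      show ?thesis
        by (simp add: scaleR_minus_right)
    qed
    then have "(\<lambda>n. ((- t) ^ n / fact n) *\<^sub>R ((-1) ^ n *\<^sub>R S (- 0) (\<alpha> (n + k)))) sums
        ((-1) ^ 0 *\<^sub>R S (- (- t)) (\<alpha> (0 + k)))"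
      by (rule taylor_sums[where \<Phi> = "\<lambda>n s. (-1) ^ n *\<^sub>R S (- s) (\<alpha> (n + k))" and M = M])
         (use bound False in auto)
    moreover have "(- t) ^ n / fact n * (-1) ^ n = t ^ n / fact n" for n
      using power_mult_distrib[of "- t" "-1" n] by simp
    ultimately show ?thesis
      by simp
  qed
  then show ?thesis
    unfolding exp_series_def by (simp add: eq sums_iff)
qed

text \<open>The bounded operator \<open>S t\<close> acts on the series term by term; each
  \<open>S t (\<alpha> k)\<close> is again an exponential series, and \<open>exp_series_add\<close>
  merges the two.\<close>

lemma S_exp_series: "S t (exp_series \<alpha> w) = exp_series \<alpha> (of_real t + w)"
proof -
  have "(\<lambda>k. S t ((w ^ k / fact k) *\<^sub>C \<alpha> k)) sums S t (exp_series \<alpha> w)"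
    by (intro bounded_linear.sums[OF bounded_linear_S] exp_series_sums[OF bound])
  then have "S t (exp_series \<alpha> w) = exp_series (\<lambda>k. S t (\<alpha> k)) w"
    unfolding exp_series_def by (simp add: S_scaleC sums_iff)
  also have "\<dots> = exp_series \<alpha> (of_real t + w)"
    unfolding S_eq_exp_series by (rule exp_series_add[OF bound])
  finally show ?thesis .
qed

text \<open>The isometry \<open>S (Re w)\<close> carries the value at i Im w to the value at
  \<open>w\<close>, so the crude bound by the exponential of the modulus is needed on the imaginary
  axis only.\<close>

lemma norm_exp_series_le_Im: "norm (exp_series \<alpha> w) \<le> exp \<bar>Im w\<bar> * M"
proof -
  have "norm (exp_series \<alpha> w) = norm (S (Re w) (exp_series \<alpha> (\<i> * of_real (Im w))))"
    by (simp add: S_exp_series flip: complex_eq del: norm_S)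
  also have "\<dots> \<le> exp (norm (\<i> * of_real (Im w))) * M"
    unfolding norm_S by (rule norm_exp_series_le[OF bound])
  finally show ?thesis
    by (simp add: norm_mult)
qed

end

subsection \<open>Contour integrals of vector-valued power series\<close>

text \<open>Integration of the power series against the scalar kernel \<open>K\<close>, term by
  term. The M-test gives uniform convergence in the parameter of the segment; \<open>J\<close> is
  the integral of the vector-valued sum, hence inherits its pointwise bound.\<close>

lemma sums_contour_integral_linepath:
  fixes b :: "nat \<Rightarrow> 'a::complex_banach"
  assumes K: "continuous_on (closed_segment p q) K"
    and summable: "\<And>r::real. summable (\<lambda>m. r ^ m * norm (b m))"
    and bound: "\<And>w. w \<in> closed_segment p q \<Longrightarrow> norm (K w *\<^sub>C (\<Sum>m. w ^ m *\<^sub>C b m)) \<le> B"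
  shows "\<exists>J. (\<lambda>m. contour_integral (linepath p q) (\<lambda>w. w ^ m * K w) *\<^sub>C b m) sums J
    \<and> norm J \<le> B * norm (q - p)"
proof -
  define \<gamma> where "\<gamma> = linepath p q"
  define F where "F m t = ((\<gamma> t) ^ m * K (\<gamma> t) * (q - p)) *\<^sub>C b m" for m t
  have \<gamma>: "\<gamma> t \<in> closed_segment p q" if "t \<in> {0..1}" for t
    using that path_image_linepath[of p q] by (auto simp: \<gamma>_def path_image_def)
  have cont_\<gamma>: "continuous_on {0..1} \<gamma>"
    unfolding \<gamma>_def by (rule continuous_on_linepath)
  have cont_K\<gamma>: "continuous_on {0..1} (\<lambda>t. K (\<gamma> t))"
    by (rule continuous_on_compose2[OF K cont_\<gamma>]) (use \<gamma> in auto)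
  have cont_F: "continuous_on {0..1} (F m)" for m
    unfolding F_def by (intro scaleC.continuous_on continuous_intros cont_\<gamma> cont_K\<gamma>)
  obtain R where R: "\<And>t. t \<in> {0..1} \<Longrightarrow> norm (\<gamma> t) \<le> R" "0 \<le> R"
    using compact_imp_bounded[OF compact_continuous_image[OF cont_\<gamma> compact_Icc]]
    unfolding bounded_pos by (metis image_eqI less_imp_le)
  obtain C where C: "\<And>t. t \<in> {0..1} \<Longrightarrow> norm (K (\<gamma> t)) \<le> C" "0 \<le> C"
    using compact_imp_bounded[OF compact_continuous_image[OF cont_K\<gamma> compact_Icc]]
    unfolding bounded_pos by (metis image_eqI less_imp_le)
  have lim: "uniform_limit {0..1} (\<lambda>n t. \<Sum>m<n. F m t) (\<lambda>t. \<Sum>m. F m t) sequentially"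
  proof (rule Weierstrass_m_test)
    show "norm (F m t) \<le> R ^ m * norm (b m) * (C * norm (q - p))" if "t \<in> {0..1}" for m t
    proof -
      have "norm (F m t) = norm (\<gamma> t) ^ m * norm (K (\<gamma> t)) * norm (q - p) * norm (b m)"
        by (simp add: F_def norm_scaleC norm_mult norm_power)
      also have "\<dots> \<le> R ^ m * C * norm (q - p) * norm (b m)"
        by (intro mult_right_mono mult_mono power_mono R C that) (use R C in auto)
      finally show ?thesis
        by (simp add: mult_ac)
    qed
    show "summable (\<lambda>m. R ^ m * norm (b m) * (C * norm (q - p)))"
      by (intro summable_mult2 summable)
  qed
  obtain I J where I: "\<And>n. ((\<lambda>t. \<Sum>m<n. F m t) has_integral I n) {0..1}"
    and J: "((\<lambda>t. \<Sum>m. F m t) has_integral J) {0..1}" and IJ: "I \<longlonglongrightarrow> J"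
    by (rule uniform_limit_integral[OF lim])
       (auto intro!: continuous_on_sum cont_F)
  have "(F m has_integral (contour_integral (linepath p q) (\<lambda>w. w ^ m * K w) *\<^sub>C b m)) {0..1}" for m
  proof -
    have "(\<lambda>w. w ^ m * K w) contour_integrable_on linepath p q"
      by (intro contour_integrable_continuous_linepath continuous_intros K)
    then have "((\<lambda>w. w ^ m * K w) has_contour_integral
        contour_integral (linepath p q) (\<lambda>w. w ^ m * K w)) (linepath p q)"
      by (rule has_contour_integral_integral)
    then have "((\<lambda>t. \<gamma> t ^ m * K (\<gamma> t) * (q - p)) has_integral
        contour_integral (linepath p q) (\<lambda>w. w ^ m * K w)) {0..1}"
      by (simp add: has_contour_integral_linepath \<gamma>_def)
    from has_integral_linear[OF this scaleC.bounded_linear_left[of "b m"]]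
    show ?thesis
      by (simp add: o_def F_def[abs_def])
  qed
  then have "((\<lambda>t. \<Sum>m<n. F m t) has_integral
      (\<Sum>m<n. contour_integral (linepath p q) (\<lambda>w. w ^ m * K w) *\<^sub>C b m)) {0..1}" for n
    by (intro has_integral_sum) auto
  with I have "I = (\<lambda>n. \<Sum>m<n. contour_integral (linepath p q) (\<lambda>w. w ^ m * K w) *\<^sub>C b m)"
    by (metis (no_types, lifting) has_integral_unique)
  with IJ have "(\<lambda>m. contour_integral (linepath p q) (\<lambda>w. w ^ m * K w) *\<^sub>C b m) sums J"
    by (simp add: sums_def)
  moreover have "norm J \<le> (B * norm (q - p)) * measure lborel (cbox 0 (1::real))"
  proof (rule has_integral_bound)
    show "0 \<le> B * norm (q - p)"
      using order_trans[OF norm_ge_zero bound[of p]] by simp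
    show "((\<lambda>t. \<Sum>m. F m t) has_integral J) (cbox 0 1)"
      using J by simp
    fix t :: real
    assume "t \<in> cbox 0 1"
    then have t: "t \<in> {0..1}"
      by simp
    have "summable (\<lambda>m. \<gamma> t ^ m *\<^sub>C b m)"
      using summable[of "norm (\<gamma> t)"]
      by (intro summable_norm_cancel[of "\<lambda>m. \<gamma> t ^ m *\<^sub>C b m"]) (simp add: norm_scaleC norm_power)
    from bounded_linear.sums[OF scaleC.bounded_linear_right
        bounded_linear.sums[OF scaleC.bounded_linear_right summable_sums[OF this]]]
    have "(\<lambda>m. (q - p) *\<^sub>C (K (\<gamma> t) *\<^sub>C (\<gamma> t ^ m *\<^sub>C b m))) sums
        ((q - p) *\<^sub>C (K (\<gamma> t) *\<^sub>C (\<Sum>m. \<gamma> t ^ m *\<^sub>C b m)))" .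
    then have "(\<Sum>m. F m t) = (q - p) *\<^sub>C (K (\<gamma> t) *\<^sub>C (\<Sum>m. \<gamma> t ^ m *\<^sub>C b m))"
      by (simp add: F_def sums_iff scaleC_scaleC mult_ac)
    also have "norm \<dots> \<le> norm (q - p) * B"
      unfolding norm_scaleC[of "q - p"] by (intro mult_left_mono bound \<gamma> t) simp
    finally show "norm (\<Sum>m. F m t) \<le> B * norm (q - p)"
      by (simp add: mult.commute)
  qed
  ultimately show ?thesis
    by auto
qed

text \<open>The four sides are treated separately; none is longer than the diagonal, whence the
  factor 4.\<close>

lemma sums_contour_integral_rectpath:
  fixes b :: "nat \<Rightarrow> 'a::complex_banach"
  assumes K: "continuous_on (path_image (rectpath p q)) K"
    and summable: "\<And>r::real. summable (\<lambda>m. r ^ m * norm (b m))"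
    and bound: "\<And>w. w \<in> path_image (rectpath p q) \<Longrightarrow> norm (K w *\<^sub>C (\<Sum>m. w ^ m *\<^sub>C b m)) \<le> B"
  shows "\<exists>J. (\<lambda>m. contour_integral (rectpath p q) (\<lambda>w. w ^ m * K w) *\<^sub>C b m) sums J
    \<and> norm J \<le> B * (4 * norm (q - p))"
proof -
  define p' where "p' = Complex (Re q) (Im p)"
  define q' where "q' = Complex (Re p) (Im q)"
  have rect: "rectpath p q = linepath p p' +++ linepath p' q +++ linepath q q' +++ linepath q' p"
    by (simp add: rectpath_def p'_def q'_def Let_def)
  have image: "path_image (rectpath p q) =
      closed_segment p p' \<union> closed_segment p' q \<union> closed_segment q q' \<union> closed_segment q' p"
    by (simp add: rect path_image_join Un_assoc)
  have side: "\<exists>J. (\<lambda>m. contour_integral (linepath u v) (\<lambda>w. w ^ m * K w) *\<^sub>C b m) sums J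
      \<and> norm J \<le> B * norm (v - u)" if "closed_segment u v \<subseteq> path_image (rectpath p q)" for u v
    by (rule sums_contour_integral_linepath)
       (use that in \<open>auto intro: continuous_on_subset[OF K] summable bound\<close>)
  have integral: "((\<lambda>w. w ^ m * K w) has_contour_integral
      contour_integral (linepath u v) (\<lambda>w. w ^ m * K w)) (linepath u v)"
    if "closed_segment u v \<subseteq> path_image (rectpath p q)" for u v m
    by (intro has_contour_integral_integral contour_integrable_continuous_linepath
        continuous_intros continuous_on_subset[OF K that])
  obtain J1 J2 J3 J4 where
    J1: "(\<lambda>m. contour_integral (linepath p p') (\<lambda>w. w ^ m * K w) *\<^sub>C b m) sums J1"
      "norm J1 \<le> B * norm (p' - p)" and
    J2: "(\<lambda>m. contour_integral (linepath p' q) (\<lambda>w. w ^ m * K w) *\<^sub>C b m) sums J2"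
      "norm J2 \<le> B * norm (q - p')" and
    J3: "(\<lambda>m. contour_integral (linepath q q') (\<lambda>w. w ^ m * K w) *\<^sub>C b m) sums J3"
      "norm J3 \<le> B * norm (q' - q)" and
    J4: "(\<lambda>m. contour_integral (linepath q' p) (\<lambda>w. w ^ m * K w) *\<^sub>C b m) sums J4"
      "norm J4 \<le> B * norm (p - q')"
    using side[of p p'] side[of p' q] side[of q q'] side[of q' p] unfolding image by blast
  have "contour_integral (rectpath p q) (\<lambda>w. w ^ m * K w) =
      contour_integral (linepath p p') (\<lambda>w. w ^ m * K w)
    + (contour_integral (linepath p' q) (\<lambda>w. w ^ m * K w)
    + (contour_integral (linepath q q') (\<lambda>w. w ^ m * K w)
    + contour_integral (linepath q' p) (\<lambda>w. w ^ m * K w)))" for m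
    unfolding rect
    by (intro contour_integral_unique has_contour_integral_join integral valid_path_join
        valid_path_linepath) (auto simp: image)
  then have "(\<lambda>m. contour_integral (rectpath p q) (\<lambda>w. w ^ m * K w) *\<^sub>C b m) sums (J1 + (J2 + (J3 + J4)))"
    by (simp add: scaleC_add_left) (intro sums_add J1 J2 J3 J4)
  moreover have "norm (J1 + (J2 + (J3 + J4))) \<le> B * (4 * norm (q - p))"
  proof -
    have "0 \<le> B"
      using order_trans[OF norm_ge_zero bound[of p]] image by simp
    have "norm (p' - p) \<le> norm (q - p)" "norm (q - p') \<le> norm (q - p)"
      "norm (q' - q) \<le> norm (q - p)" "norm (p - q') \<le> norm (q - p)"
      using abs_Re_le_cmod[of "q - p"] abs_Im_le_cmod[of "q - p"]
      by (simp_all add: p'_def q'_def cmod_def abs_minus_commute)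
    from this[THEN mult_left_mono, OF \<open>0 \<le> B\<close>] J1(2) J2(2) J3(2) J4(2)
    have "norm J1 + (norm J2 + (norm J3 + norm J4)) \<le> B * (4 * norm (q - p))"
      by linarith
    then show ?thesis
      by (meson norm_triangle_le order_trans add_left_mono norm_triangle_ineq)
  qed
  ultimately show ?thesis
    by blast
qed

subsection \<open>Residues of the interpolation kernel\<close>

lemma sin_int_pi [simp]: "sin (of_int k * of_real pi :: complex) = 0"
  by (simp add: sin_eq_0)

lemma cos_int_pi_square: "cos (of_int k * of_real pi :: complex) * cos (of_int k * of_real pi) = 1"
  using sin_cos_squared_add3[of "of_int k * of_real pi :: complex"] by simp

text \<open>All poles are simple, as \<open>\<zeta>\<close> is not a zero of the sine. Near k pi the
  sine behaves like cos(k pi) (w - k pi), and cos(k pi) is its own inverse, so it ends up in the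
  numerator.\<close>

lemma residue_power_over_sin:
  fixes \<zeta> :: complex
  assumes "sin \<zeta> \<noteq> 0"
  shows residue_power_over_sin_int_pi:
      "residue (\<lambda>w. w ^ m * (1 / ((w - \<zeta>) * sin w))) (of_int k * of_real pi)
        = (of_int k * of_real pi) ^ m * (cos (of_int k * of_real pi) / (of_int k * of_real pi - \<zeta>))"
    and residue_power_over_sin_zeta:
      "residue (\<lambda>w. w ^ m * (1 / ((w - \<zeta>) * sin w))) \<zeta> = \<zeta> ^ m / sin \<zeta>"
proof -
  let ?p = "of_int k * of_real pi :: complex"
  have ne: "?p \<noteq> \<zeta>"
    using assms by auto
  show "residue (\<lambda>w. w ^ m * (1 / ((w - \<zeta>) * sin w))) ?p = ?p ^ m * (cos ?p / (?p - \<zeta>))"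
  proof (rule residue_simple'[where s = "ball ?p 1 - {\<zeta>}"])
    \<comment> \<open>Distinct multiples of pi are more than 1 apart, so the unit ball contains no
      other zero of the sine.\<close>
    have "sin w \<noteq> 0" if "w \<in> ball ?p 1 - {?p}" for w
    proof
      assume "sin w = 0"
      then obtain n :: int where n: "w = of_int n * of_real pi"
        by (auto simp: sin_eq_0)
      with that have "n \<noteq> k" by auto
      then have "1 \<le> \<bar>of_int (k - n) :: real\<bar>"
        by linarith
      also have "\<dots> \<le> \<bar>of_int (k - n)\<bar> * pi"
        using pi_ge_two by (intro mult_le_cancel_left1[THEN iffD2]) auto
      also have "\<dots> = norm (of_int (k - n) * of_real pi :: complex)"
        by (simp add: norm_mult del: of_int_diff)
      also have "\<dots> = dist ?p w"
        by (simp add: dist_norm n algebra_simps)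
      finally show False
        using that by simp
    qed
    then show "(\<lambda>w. w ^ m * (1 / ((w - \<zeta>) * sin w))) holomorphic_on ball ?p 1 - {\<zeta>} - {?p}"
      by (auto intro!: holomorphic_intros)
    have "((\<lambda>w. (sin w - sin ?p) / (w - ?p)) \<longlongrightarrow> cos ?p) (at ?p)"
      using DERIV_sin[of ?p] by (simp add: has_field_derivative_iff)
    then have "((\<lambda>w. w ^ m * (inverse (sin w / (w - ?p)) / (w - \<zeta>))) \<longlongrightarrow>
        ?p ^ m * (inverse (cos ?p) / (?p - \<zeta>))) (at ?p)"
      using ne cos_int_pi_square[of k] by (intro tendsto_intros) auto
    then show "((\<lambda>w. w ^ m * (1 / ((w - \<zeta>) * sin w)) * (w - ?p)) \<longlongrightarrow>
        ?p ^ m * (cos ?p / (?p - \<zeta>))) (at ?p)"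
      unfolding inverse_unique[OF cos_int_pi_square[of k]] by (simp add: divide_inverse mult_ac)
  qed (use ne in auto)
  show "residue (\<lambda>w. w ^ m * (1 / ((w - \<zeta>) * sin w))) \<zeta> = \<zeta> ^ m / sin \<zeta>"
  proof (rule residue_simple'[where s = "- {w. sin w = 0}"])
    show "open (- {w::complex. sin w = 0})"
      by (intro open_Compl closed_Collect_eq continuous_intros)
    show "(\<lambda>w. w ^ m * (1 / ((w - \<zeta>) * sin w))) holomorphic_on - {w. sin w = 0} - {\<zeta>}"
      by (auto intro!: holomorphic_intros)
    have "((\<lambda>w. w ^ m / sin w) \<longlongrightarrow> \<zeta> ^ m / sin \<zeta>) (at \<zeta>)"
      using assms by (intro tendsto_intros) auto
    then show "((\<lambda>w. w ^ m * (1 / ((w - \<zeta>) * sin w)) * (w - \<zeta>)) \<longlongrightarrow> \<zeta> ^ m / sin \<zeta>) (at \<zeta>)"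
      by (rule Lim_transform_eventually) (auto simp: eventually_at_filter divide_simps)
  qed (use assms in auto)
qed

text \<open>The half-integer in \<open>r\<close> keeps the contour away from the multiples of pi;
  exactly those with \<bar>k\<bar> \<le> N lie inside, together with \<open>\<zeta>\<close>, each
  with winding number 1.\<close>

lemma contour_integral_power_over_sin:
  fixes \<zeta> :: complex and N :: nat
  defines "r \<equiv> (real N + 1 / 2) * pi"
  assumes "sin \<zeta> \<noteq> 0" and "norm \<zeta> < r"
  shows "contour_integral (rectpath (Complex (-r) (-r)) (Complex r r))
        (\<lambda>w. w ^ m * (1 / ((w - \<zeta>) * sin w)))
    = 2 * pi * \<i> * ((\<Sum>k = - int N..int N. (of_int k * of_real pi) ^ m *
          (cos (of_int k * of_real pi) / (of_int k * of_real pi - \<zeta>))) + \<zeta> ^ m / sin \<zeta>)"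
proof -
  let ?p = "\<lambda>k::int. of_int k * of_real pi :: complex"
  let ?g = "rectpath (Complex (-r) (-r)) (Complex r r)"
  let ?f = "\<lambda>w. w ^ m * (1 / ((w - \<zeta>) * sin w))"
  define A where "A = ?p ` {- int N..int N}"
  \<comment> \<open>A convex open strip containing the square and no further poles, so that the set
    of singularities is finite.\<close>
  define S where "S = {w. \<bar>Re w\<bar> < (real N + 1) * pi}"
  have r: "0 < r" "r < (real N + 1) * pi"
    by (auto simp: r_def add_nonneg_pos)
  have S_eq: "S = {w. Re w < (real N + 1) * pi} \<inter> {w. Re w > - ((real N + 1) * pi)}"
    by (auto simp: S_def)
  have S: "open S" "convex S"
    unfolding S_eq
    by (intro open_Int convex_Int open_halfspace_Re_lt open_halfspace_Re_gt
        convex_halfspace_Re_lt convex_halfspace_Re_gt)+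
  have poles: "w \<in> A" if w: "w \<in> S" "sin w = 0" for w
  proof -
    obtain n :: int where n: "w = of_real (of_int n * pi)"
      using w unfolding sin_eq_0 by blast
    with w have "\<bar>real_of_int n\<bar> * pi < (real N + 1) * pi"
      by (simp add: S_def abs_mult)
    then have "\<bar>real_of_int n\<bar> < real N + 1"
      by simp
    then have "n \<in> {- int N..int N}"
      by auto
    with n show ?thesis
      by (auto simp: A_def)
  qed
  have abs_less_r: "\<bar>Re \<zeta>\<bar> < r" "\<bar>Im \<zeta>\<bar> < r"
    using \<open>norm \<zeta> < r\<close> abs_Re_le_cmod[of \<zeta>] abs_Im_le_cmod[of \<zeta>] by linarith+
  have A_box: "insert \<zeta> A \<subseteq> box (Complex (-r) (-r)) (Complex r r)"
  proof -
    have "\<bar>of_int k * pi\<bar> < r" if "k \<in> {- int N..int N}" for k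
    proof -
      have "\<bar>real_of_int k\<bar> < real N + 1 / 2"
        using that by auto
      then show ?thesis
        by (simp add: r_def abs_mult)
    qed
    then show ?thesis
      using abs_less_r r by (fastforce simp: A_def in_box_complex_iff abs_less_iff)
  qed
  have image: "path_image ?g = cbox (Complex (-r) (-r)) (Complex r r) - box (Complex (-r) (-r)) (Complex r r)"
    using r by (intro path_image_rectpath_cbox_minus_box) auto
  have "contour_integral ?g ?f
      = 2 * pi * \<i> * (\<Sum>p\<in>insert \<zeta> A. winding_number ?g p * residue ?f p)"
  proof (rule Residue_theorem)
    show "?f holomorphic_on S - insert \<zeta> A"
      using poles by (auto intro!: holomorphic_intros)
    have sub: "path_image ?g \<subseteq> S"
      unfolding image S_def using r by (auto simp: in_cbox_complex_iff)
    then show "path_image ?g \<subseteq> S - insert \<zeta> A"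
      using image A_box by blast
    show "\<forall>z. z \<notin> S \<longrightarrow> winding_number ?g z = 0"
      using sub S by (auto intro!: winding_number_zero_outside)
  qed (use S in \<open>auto simp: A_def convex_connected\<close>)
  also have "(\<Sum>p\<in>insert \<zeta> A. winding_number ?g p * residue ?f p) = (\<Sum>p\<in>insert \<zeta> A. residue ?f p)"
    using A_box by (intro sum.cong) (auto simp: winding_number_rectpath)
  also have "\<dots> = residue ?f \<zeta> + (\<Sum>p\<in>A. residue ?f p)"
    using assms by (subst sum.insert) (auto simp: A_def)
  also have "(\<Sum>p\<in>A. residue ?f p) = (\<Sum>k = - int N..int N. residue ?f (?p k))"
    unfolding A_def by (rule sum.reindex_cong[OF _ refl refl]) (auto simp: inj_on_def)
  finally show ?thesis
    by (simp only: residue_power_over_sin_int_pi[OF assms(2)] residue_power_over_sin_zeta[OF assms(2)] add.commute)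
qed

text \<open>From \<bar>sin(x + iy)\<bar>^2 = (cosh 2y - cos 2x) / 2: on the vertical sides the
  cosine is -1, on the horizontal sides the exponential outweighs it.\<close>

lemma norm_sin_ge_on_square:
  fixes N :: nat
  defines "r \<equiv> (real N + 1 / 2) * pi"
  assumes "w \<in> path_image (rectpath (Complex (-r) (-r)) (Complex r r))"
  shows "exp \<bar>Im w\<bar> \<le> 4 * norm (sin w)" and "r \<le> norm w"
proof -
  have r: "0 < r"
    by (simp add: r_def add_nonneg_pos)
  have sides: "(\<bar>Re w\<bar> = r \<or> \<bar>Im w\<bar> = r)"
    using assms(2) r by (auto simp: path_image_rectpath)
  then show "r \<le> norm w"
    using abs_Re_le_cmod[of w] abs_Im_le_cmod[of w] by auto
  have norm_sin: "norm (sin w) ^ 2 = (exp (2 * \<bar>Im w\<bar>) + exp (- 2 * \<bar>Im w\<bar>) - 2 * cos (2 * \<bar>Re w\<bar>)) / 4"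
    by (auto simp: norm_sin_squared abs_if exp_minus cos_minus)
  have "exp (2 * \<bar>Im w\<bar>) \<le> 16 * norm (sin w) ^ 2"
  proof (cases "\<bar>Re w\<bar> = r")
    case True
    \<comment> \<open>Here 2 r is an odd multiple of pi.\<close>
    have "cos (2 * r) = cos (real (2 * N + 1) * pi)"
      by (simp add: r_def algebra_simps)
    also have "\<dots> = -1"
      by (subst cos_npi) simp
    finally show ?thesis
      using True exp_ge_zero[of "- 2 * \<bar>Im w\<bar>"] exp_ge_zero[of "2 * \<bar>Im w\<bar>"] by (simp add: norm_sin)
  next
    case False
    then have "\<bar>Im w\<bar> = r"
      using sides by simp
    moreover have "1 \<le> r"
    proof -
      have "1 / 2 * 2 \<le> (real N + 1 / 2) * pi"
        using pi_ge_two by (intro mult_mono) auto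
      then show ?thesis
        by (simp add: r_def)
    qed
    \<comment> \<open>With E = exp(2 \<bar>Im w\<bar>), 16 \<bar>sin w\<bar>^2 is at least 4 E - 8,
      which is at least E precisely when E \<ge> 8/3.\<close>
    ultimately have "8 / 3 \<le> exp (2 * \<bar>Im w\<bar>)"
      using exp_ge_add_one_self[of "2 * \<bar>Im w\<bar>"] by linarith
    then show ?thesis
      using cos_le_one[of "2 * \<bar>Re w\<bar>"] exp_ge_zero[of "- 2 * \<bar>Im w\<bar>"]
      unfolding norm_sin by argo
  qed
  then have "exp \<bar>Im w\<bar> ^ 2 \<le> (4 * norm (sin w)) ^ 2"
    by (simp add: power_mult_distrib flip: exp_double)
  then show "exp \<bar>Im w\<bar> \<le> 4 * norm (sin w)"
    by (rule power2_le_imp_le) simp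
qed

subsection \<open>The interpolation series\<close>

text \<open>\<open>X N\<close> is 1/(2 pi i) times the integral of H(w) / ((w - \<zeta>) sin w) over
  the N-th square. The integrand is of order 1/r^2 and the perimeter of order r, so
  \<open>X N\<close> tends to 0; solving for the term at \<open>\<zeta>\<close> reverses the sign of
  the denominators.\<close>

lemma symmetric_interpolation_tendsto:
  fixes b :: "nat \<Rightarrow> 'a::complex_banach" and \<zeta> :: complex
  defines "H \<equiv> \<lambda>w. \<Sum>m. w ^ m *\<^sub>C b m"
  assumes summable: "\<And>r::real. summable (\<lambda>m. r ^ m * norm (b m))"
    and growth: "\<And>w. 1 \<le> norm w \<Longrightarrow> norm w * norm (H w) \<le> C * exp \<bar>Im w\<bar>"
    and sin: "sin \<zeta> \<noteq> 0"
  shows "(\<lambda>N. \<Sum>k = - int N..int N. (cos (of_int k * of_real pi) / (\<zeta> - of_int k * of_real pi))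
      *\<^sub>C H (of_int k * of_real pi)) \<longlonglongrightarrow> (1 / sin \<zeta>) *\<^sub>C H \<zeta>"
proof -
  let ?p = "\<lambda>k::int. of_int k * of_real pi :: complex"
  define r where "r N = (real N + 1 / 2) * pi" for N
  define X where "X N = (\<Sum>k = - int N..int N. (cos (?p k) / (?p k - \<zeta>)) *\<^sub>C H (?p k))
      + (1 / sin \<zeta>) *\<^sub>C H \<zeta>" for N
  have H: "(\<lambda>m. w ^ m *\<^sub>C b m) sums H w" for w
    unfolding H_def
    by (intro summable_sums summable_norm_cancel[of "\<lambda>m. w ^ m *\<^sub>C b m"])
       (simp add: norm_scaleC norm_power summable)
  have C: "0 \<le> C"
    using order_trans[OF mult_nonneg_nonneg growth[of 1]] by simp
  \<comment> \<open>The constant is 4 * 4 * 4: from the lower bound for the sine, from the four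
    sides, and from the estimate of the diagonal by 4 r. The factor 2 pi is estimated from below by
    1.\<close>
  have X_le: "norm (X N) \<le> 64 * C / (r N - norm \<zeta>)" if "norm \<zeta> + 1 \<le> r N" for N
  proof -
    let ?r = "r N"
    let ?g = "rectpath (Complex (- ?r) (- ?r)) (Complex ?r ?r)"
    let ?K = "\<lambda>w. 1 / ((w - \<zeta>) * sin w)"
    have r: "0 < ?r" "norm \<zeta> < ?r" "1 \<le> ?r"
      using that norm_ge_zero[of \<zeta>] by linarith+
    have far: "?r \<le> norm w" "?r - norm \<zeta> \<le> norm (w - \<zeta>)" "exp \<bar>Im w\<bar> \<le> 4 * norm (sin w)"
      if "w \<in> path_image ?g" for w
      using norm_sin_ge_on_square[OF that[unfolded r_def]] norm_triangle_ineq2[of w \<zeta>]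
      unfolding r_def by linarith+
    have nz: "w - \<zeta> \<noteq> 0" "sin w \<noteq> 0" if "w \<in> path_image ?g" for w
      using far[OF that] r exp_gt_zero[of "\<bar>Im w\<bar>"] by auto
    have bound: "norm (?K w *\<^sub>C (\<Sum>m. w ^ m *\<^sub>C b m)) \<le> 4 * C / (?r * (?r - norm \<zeta>))"
      if w: "w \<in> path_image ?g" for w
    proof -
      \<comment> \<open>The exponential growth of \<open>H\<close> is absorbed by that of the sine
        on the contour.\<close>
      have "?r * norm (H w) \<le> norm w * norm (H w)"
        by (intro mult_right_mono far w) simp
      also have "\<dots> \<le> C * exp \<bar>Im w\<bar>"
        using far(1)[OF w] r by (intro growth) linarith
      also have "\<dots> \<le> C * (4 * norm (sin w))"
        by (intro mult_left_mono far w C)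
      finally have *: "?r * norm (H w) \<le> C * (4 * norm (sin w))" .
      have "(?r - norm \<zeta>) * (?r * norm (H w)) \<le> norm (w - \<zeta>) * (C * (4 * norm (sin w)))"
        by (intro mult_mono far w *) (use r in auto)
      then have "norm (H w) / (norm (w - \<zeta>) * norm (sin w)) \<le> 4 * C / (?r * (?r - norm \<zeta>))"
        using nz[OF w] r by (simp add: divide_simps mult_ac)
      then show ?thesis
        by (simp add: H_def norm_scaleC norm_divide norm_mult)
    qed
    have "continuous_on (path_image ?g) ?K"
      using nz by (intro continuous_intros) auto
    note sums_contour_integral_rectpath[OF this summable bound]
    then obtain J where J: "(\<lambda>m. contour_integral ?g (\<lambda>w. w ^ m * ?K w) *\<^sub>C b m) sums J"
      and J_le: "norm J \<le> 4 * C / (?r * (?r - norm \<zeta>)) * (4 * norm (Complex ?r ?r - Complex (- ?r) (- ?r)))"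
      by blast
    \<comment> \<open>The residues of each monomial, weighted by \<open>b m\<close>, sum over
      \<open>m\<close> to the values of \<open>H\<close> at the poles, so uniqueness of sums
      identifies \<open>J\<close>.\<close>
    have "contour_integral ?g (\<lambda>w. w ^ m * ?K w) *\<^sub>C b m = (2 * pi * \<i>) *\<^sub>C
        ((\<Sum>k = - int N..int N. (cos (?p k) / (?p k - \<zeta>)) *\<^sub>C (?p k ^ m *\<^sub>C b m))
          + (1 / sin \<zeta>) *\<^sub>C (\<zeta> ^ m *\<^sub>C b m))" for m
      using r(2) unfolding r_def
      by (subst contour_integral_power_over_sin[OF sin])
         (simp_all add: scaleC_scaleC scaleC_add_left scaleC_add_right scaleC.sum_left scaleC.sum_right
           distrib_left sum_distrib_left mult_ac)
    moreover have "(\<lambda>m. (2 * pi * \<i>) *\<^sub>C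
        ((\<Sum>k = - int N..int N. (cos (?p k) / (?p k - \<zeta>)) *\<^sub>C (?p k ^ m *\<^sub>C b m))
          + (1 / sin \<zeta>) *\<^sub>C (\<zeta> ^ m *\<^sub>C b m))) sums ((2 * pi * \<i>) *\<^sub>C X N)"
      unfolding X_def
      by (intro bounded_linear.sums[OF scaleC.bounded_linear_right] sums_add sums_sum H)
    ultimately have "J = (2 * pi * \<i>) *\<^sub>C X N"
      using J sums_unique2 by simp
    then have "norm J = 2 * pi * norm (X N)"
      by (simp add: norm_scaleC norm_mult)
    moreover have "1 * norm (X N) \<le> 2 * pi * norm (X N)"
      using pi_ge_two by (intro mult_right_mono) auto
    moreover have "norm (Complex ?r ?r - Complex (- ?r) (- ?r)) \<le> 4 * ?r"
      using r cmod_le[of "Complex ?r ?r - Complex (- ?r) (- ?r)"] by simp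
    then have "4 * C / (?r * (?r - norm \<zeta>)) * (4 * norm (Complex ?r ?r - Complex (- ?r) (- ?r)))
        \<le> 4 * C / (?r * (?r - norm \<zeta>)) * (4 * (4 * ?r))"
      using r C by (intro mult_left_mono) auto
    moreover have "\<dots> = 64 * C / (?r - norm \<zeta>)"
      using r by (simp add: field_simps)
    ultimately show ?thesis
      using J_le by linarith
  qed
  have r_lim: "filterlim r at_top sequentially"
    unfolding r_def by real_asymp
  have "X \<longlonglongrightarrow> 0"
  proof (rule Lim_null_comparison)
    show "eventually (\<lambda>N. norm (X N) \<le> 64 * C / (r N - norm \<zeta>)) sequentially"
      using r_lim[unfolded filterlim_at_top, rule_format, of "norm \<zeta> + 1"]
      by eventually_elim (rule X_le)
    show "(\<lambda>N. 64 * C / (r N - norm \<zeta>)) \<longlonglongrightarrow> 0"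
      unfolding r_def by real_asymp
  qed
  from tendsto_diff[OF tendsto_const[of "(1 / sin \<zeta>) *\<^sub>C H \<zeta>"] this]
  have "(\<lambda>N. - (\<Sum>k = - int N..int N. (cos (?p k) / (?p k - \<zeta>)) *\<^sub>C H (?p k)))
      \<longlonglongrightarrow> (1 / sin \<zeta>) *\<^sub>C H \<zeta>"
    by (simp add: X_def)
  then show ?thesis
    by (simp add: sum_negf[symmetric] scaleC.minus_left[symmetric] minus_divide_right)
qed

section \<open>The cardinal sine, a bound for the sine, and sums over the integers\<close>

lemma csinc_div_pi: "csinc (w / of_real pi) = (if w = 0 then 1 else sin w / w)"
  by (simp add: csinc_def)

text \<open>Brings the shifted cardinal sine into the shape of the residue coefficients, by the
  addition theorem at a zero of the sine.\<close>

lemma csinc_div_pi_minus_int: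
  assumes "w \<noteq> of_int k * of_real pi"
  shows "csinc (w / of_real pi - of_int k)
    = sin w * cos (of_int k * of_real pi) / (w - of_int k * of_real pi)"
proof -
  have "w / of_real pi - of_int k = (w - of_int k * of_real pi) / of_real pi"
    by (simp add: diff_divide_distrib)
  then show ?thesis
    using assms by (simp only: csinc_div_pi) (simp add: sin_diff)
qed

lemma norm_sin_le_exp: "norm (sin w :: complex) \<le> exp \<bar>Im w\<bar>"
proof -
  have "norm (sin w) = norm (exp (\<i> * w) - exp (- (\<i> * w))) / 2"
    by (simp add: sin_exp_eq norm_divide norm_mult)
  also have "\<dots> \<le> (norm (exp (\<i> * w)) + norm (exp (- (\<i> * w)))) / 2"
    by (intro divide_right_mono norm_triangle_ineq4) simp
  also have "\<dots> \<le> (exp \<bar>Im w\<bar> + exp \<bar>Im w\<bar>) / 2"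
    by (intro divide_right_mono add_mono) (auto simp: norm_exp_eq_Re)
  finally show ?thesis
    by simp
qed

text \<open>The majorant for the interpolation series. The term at 0 is 0, by the convention for
  division by zero.\<close>

lemma summable_on_inverse_square_int: "(\<lambda>k::int. 1 / (of_int k)\<^sup>2 :: real) summable_on UNIV"
proof -
  let ?f = "\<lambda>k::int. 1 / (of_int k)\<^sup>2 :: real"
  have nat: "(\<lambda>n::nat. 1 / (real n)\<^sup>2) summable_on UNIV"
    using inverse_power_summable[of 2, where 'a = real]
    by (intro norm_summable_imp_summable_on) (simp add: inverse_eq_divide)
  have "?f summable_on range int"
    using nat by (subst summable_on_reindex) (auto simp: o_def)
  moreover have "?f summable_on range (\<lambda>n. - int n)"
    using nat by (subst summable_on_reindex) (auto simp: o_def inj_on_def)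
  ultimately have "?f summable_on (range int \<union> range (\<lambda>n. - int n))"
    by (rule summable_on_union)
  also have "range int \<union> range (\<lambda>n. - int n) = UNIV"
  proof (rule UNIV_eq_I[symmetric])
    show "k \<in> range int \<union> range (\<lambda>n. - int n)" for k
      by (cases k rule: int_cases2) simp_all
  qed
  finally show ?thesis .
qed

text \<open>Links the symmetric partial sums produced by the squares to the unconditional sum: every
  finite index set is eventually covered.\<close>

lemma filterlim_symmetric_intervals:
  "filterlim (\<lambda>N. {- int N..int N} - A) (finite_subsets_at_top (UNIV - A)) sequentially"
  unfolding filterlim_finite_subsets_at_top
proof (intro allI impI)
  fix X :: "int set"
  assume X: "finite X \<and> X \<subseteq> UNIV - A"
  define n where "n = Max (insert 0 ((\<lambda>k. nat \<bar>k\<bar>) ` X))"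
  have "nat \<bar>k\<bar> \<le> n" if "k \<in> X" for k
    unfolding n_def using X that by (intro Max_ge) auto
  then have "\<bar>k\<bar> \<le> int n" if "k \<in> X" for k
    using that by fastforce
  then show "\<forall>\<^sub>F N in sequentially. finite ({- int N..int N} - A) \<and>
      X \<subseteq> {- int N..int N} - A \<and> {- int N..int N} - A \<subseteq> UNIV - A"
    using X by (intro eventually_sequentiallyI[of n]) (force simp: abs_le_iff)
qed

subsection \<open>Interpolation of the flow\<close>

context isometric_orbit
begin

lemma M_nonneg: "0 \<le> M"
  using order_trans[OF norm_ge_zero bound] .

abbreviation "flow \<equiv> exp_series \<alpha>"

lemma flow_of_real: "flow (of_real t) = S t (\<alpha> 0)"
  using S_eq_exp_series[of t 0] by simp

text \<open>The power series of \<open>(flow w - (sin w / w) *\<^sub>C \<alpha> 0) / w\<close>; subtracting \<open>sin w / w\<close> instead of 1 keeps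
  the values of \<open>flow\<close> at the nonzero multiples of \<open>\<pi>\<close> and makes all poles in the residue sum simple.\<close>

definition quotient_coeff :: "nat \<Rightarrow> 'a"
  where "quotient_coeff m = (1 / fact (Suc m)) *\<^sub>R \<alpha> (Suc m) - sin_coeff (m + 2) *\<^sub>R \<alpha> 0"

definition quotient :: "complex \<Rightarrow> 'a"
  where "quotient w = (\<Sum>m. w ^ m *\<^sub>C quotient_coeff m)"

lemma summable_quotient: "summable (\<lambda>m. r ^ m * norm (quotient_coeff m))" for r :: real
proof (rule summable_comparison_test')
  show "summable (\<lambda>m. \<bar>r\<bar> ^ m /\<^sub>R fact m * (2 * M))"
    by (intro summable_mult2 summable_exp_generic)
  fix m
  have le: "(1::real) / fact n \<le> 1 / fact m" if "m \<le> n" for n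
    using that by (intro divide_left_mono fact_mono) auto
  have "\<bar>sin_coeff (m + 2)\<bar> \<le> (1 :: real) / fact (m + 2)"
    by (auto simp: sin_coeff_def power_minus1_odd abs_mult power_abs)
  also have "\<dots> \<le> 1 / fact m"
    by (rule le) simp
  finally have "norm (quotient_coeff m) \<le> 1 / fact m * M + 1 / fact m * M"
    unfolding quotient_coeff_def
    by (intro norm_triangle_le_diff add_mono; unfold norm_scaleR)
       (intro mult_mono bound; use le[of "Suc m"] in simp)+
  then have "\<bar>r\<bar> ^ m * norm (quotient_coeff m) \<le> \<bar>r\<bar> ^ m * (1 / fact m * M + 1 / fact m * M)"
    by (intro mult_left_mono) auto
  then show "norm (r ^ m * norm (quotient_coeff m)) \<le> \<bar>r\<bar> ^ m /\<^sub>R fact m * (2 * M)"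
    by (simp add: abs_mult power_abs field_simps)
qed

lemma quotient_sums: "(\<lambda>m. w ^ m *\<^sub>C quotient_coeff m) sums quotient w"
  unfolding quotient_def
  by (intro summable_sums summable_norm_cancel[of "\<lambda>m. w ^ m *\<^sub>C quotient_coeff m"])
     (simp add: norm_scaleC norm_power summable_quotient)

text \<open>The source of the term with Df: the constant coefficient is \<open>\<alpha> 1\<close>,
  because the quadratic coefficient of the sine vanishes.\<close>

lemma quotient_0: "quotient 0 = \<alpha> 1"
proof -
  have "(\<lambda>m. if m = 0 then quotient_coeff m else 0) sums quotient_coeff 0"
    by (rule sums_single)
  moreover have "(\<lambda>m. if m = 0 then quotient_coeff m else 0) = (\<lambda>m. 0 ^ m *\<^sub>C quotient_coeff m)"
    by (auto simp: fun_eq_iff scaleC_one scaleC.zero_left power_0_left)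
  ultimately have "(\<lambda>m. 0 ^ m *\<^sub>C quotient_coeff m) sums quotient_coeff 0"
    by simp
  then have "quotient 0 = quotient_coeff 0"
    using quotient_sums[of 0] sums_unique2 by blast
  then show ?thesis
    by (simp add: quotient_coeff_def sin_coeff_def)
qed

text \<open>Free of division, hence valid at 0 as well. The shifts of index by 1 and 2 drop the
  initial terms \<open>\<alpha> 0\<close> of the flow and \<open>w\<close> of the sine, which cancel
  on the right-hand side.\<close>

lemma quotient_mult_square: "w\<^sup>2 *\<^sub>C quotient w = w *\<^sub>C flow w - sin w *\<^sub>C \<alpha> 0"
proof -
  have "(\<lambda>m. (w ^ Suc m / fact (Suc m)) *\<^sub>C \<alpha> (Suc m)) sums (flow w - \<alpha> 0)"
    using exp_series_sums[OF bound, of w]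
    by (subst sums_Suc_iff) (simp add: scaleC_one)
  then have "(\<lambda>m. w *\<^sub>C ((w ^ Suc m / fact (Suc m)) *\<^sub>C \<alpha> (Suc m))) sums (w *\<^sub>C (flow w - \<alpha> 0))"
    by (rule bounded_linear.sums[OF scaleC.bounded_linear_right])
  moreover have "(\<lambda>m. (sin_coeff (m + 2) *\<^sub>R w ^ (m + 2)) *\<^sub>C \<alpha> 0) sums ((sin w - w) *\<^sub>C \<alpha> 0)"
  proof (rule bounded_linear.sums[OF scaleC.bounded_linear_left])
    have "{..<2::nat} = {0, 1}" by auto
    then show "(\<lambda>m. sin_coeff (m + 2) *\<^sub>R w ^ (m + 2)) sums (sin w - w)"
      using sums_split_initial_segment[OF sin_converges[of w], of 2]
      by (simp add: sin_coeff_def)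
  qed
  ultimately have "(\<lambda>m. w *\<^sub>C ((w ^ Suc m / fact (Suc m)) *\<^sub>C \<alpha> (Suc m))
        - (sin_coeff (m + 2) *\<^sub>R w ^ (m + 2)) *\<^sub>C \<alpha> 0) sums
      (w *\<^sub>C (flow w - \<alpha> 0) - (sin w - w) *\<^sub>C \<alpha> 0)"
    by (rule sums_diff)
  moreover have "w *\<^sub>C ((w ^ Suc m / fact (Suc m)) *\<^sub>C \<alpha> (Suc m))
        - (sin_coeff (m + 2) *\<^sub>R w ^ (m + 2)) *\<^sub>C \<alpha> 0 = w\<^sup>2 *\<^sub>C (w ^ m *\<^sub>C quotient_coeff m)" for m
    unfolding quotient_coeff_def scaleC.diff_right scaleC_of_real[symmetric] scaleC_scaleC
    by (simp add: scaleC_complex_def power2_eq_square mult_ac)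
  moreover have "(\<lambda>m. w\<^sup>2 *\<^sub>C (w ^ m *\<^sub>C quotient_coeff m)) sums (w\<^sup>2 *\<^sub>C quotient w)"
    by (intro bounded_linear.sums[OF scaleC.bounded_linear_right] quotient_sums)
  ultimately have "w\<^sup>2 *\<^sub>C quotient w = w *\<^sub>C (flow w - \<alpha> 0) - (sin w - w) *\<^sub>C \<alpha> 0"
    using sums_unique2 by simp
  then show ?thesis
    by (simp add: scaleC.diff_right scaleC.diff_left)
qed

lemma quotient_eq:
  assumes "w \<noteq> 0"
  shows "quotient w = (1 / w) *\<^sub>C flow w - (sin w / w\<^sup>2) *\<^sub>C \<alpha> 0"
proof -
  have "quotient w = (1 / w\<^sup>2) *\<^sub>C (w\<^sup>2 *\<^sub>C quotient w)"
    using assms by (simp add: scaleC_scaleC scaleC_one)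
  also have "\<dots> = (1 / w) *\<^sub>C flow w - (sin w / w\<^sup>2) *\<^sub>C \<alpha> 0"
    unfolding quotient_mult_square using assms
    by (simp add: scaleC.diff_right scaleC_scaleC power2_eq_square)
  finally show ?thesis .
qed

lemma quotient_int_pi:
  assumes "k \<noteq> 0"
  shows "quotient (of_int k * of_real pi) = (1 / (of_int k * of_real pi)) *\<^sub>C S (of_int k * pi) (\<alpha> 0)"
  using assms flow_of_real[of "of_int k * pi"] by (simp add: quotient_eq scaleC.zero_left)

text \<open>Flow and sine both grow at most like exp \<bar>Im w\<bar>. The decay by the factor
  1/\<bar>w\<bar> is what forces the contour integrals to 0; without it they would only be
  bounded.\<close>

lemma quotient_growth:
  assumes "1 \<le> norm w"
  shows "norm w * norm (quotient w) \<le> 2 * M * exp \<bar>Im w\<bar>"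
proof -
  have "norm w * (norm w * norm (quotient w)) = norm (w *\<^sub>C flow w - sin w *\<^sub>C \<alpha> 0)"
    unfolding quotient_mult_square[symmetric] by (simp add: norm_scaleC norm_mult power2_eq_square)
  also have "\<dots> \<le> norm w * norm (flow w) + norm (sin w) * norm (\<alpha> 0)"
    using norm_triangle_ineq4[of "w *\<^sub>C flow w" "sin w *\<^sub>C \<alpha> 0"] by (simp add: norm_scaleC)
  also have "\<dots> \<le> norm w * (exp \<bar>Im w\<bar> * M) + exp \<bar>Im w\<bar> * M"
    by (intro add_mono mult_left_mono mult_mono norm_exp_series_le_Im norm_sin_le_exp bound) auto
  also have "\<dots> \<le> norm w * (exp \<bar>Im w\<bar> * M) + norm w * (exp \<bar>Im w\<bar> * M)"
    using mult_right_mono[OF assms, of "exp \<bar>Im w\<bar> * M"] M_nonneg by (simp add: mult_ac)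
  finally have "norm w * (norm w * norm (quotient w)) \<le> norm w * (2 * M * exp \<bar>Im w\<bar>)"
    by (simp add: algebra_simps)
  moreover have "0 < norm w"
    using assms by linarith
  ultimately show ?thesis
    by (rule mult_left_le_imp_le)
qed

text \<open>The summand of index \<open>k\<close> in the rescaled variable \<zeta> = \<sigma>
  z.\<close>

definition interpolation_term :: "complex \<Rightarrow> int \<Rightarrow> 'a"
  where "interpolation_term \<zeta> k =
    (\<zeta> / (of_int k * of_real pi) * csinc (\<zeta> / of_real pi - of_int k)) *\<^sub>C S (of_int k * pi) (\<alpha> 0)"

text \<open>Outside a finite set of indices the terms are of order 1/k^2: one factor 1/k is
  explicit, the other comes from the cardinal sine, and \<open>S\<close> preserves norms.\<close>

lemma interpolation_term_summable: "interpolation_term \<zeta> summable_on (UNIV - {0})"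
proof -
  \<comment> \<open>Beyond \<open>n\<close>, \<bar>k\<bar> exceeds \<bar>\<zeta>\<bar>, so
    \<bar>\<zeta> - k pi\<bar> \<ge> 2 \<bar>k\<bar> - \<bar>\<zeta>\<bar> \<ge>
    \<bar>k\<bar>.\<close>
  define n where "n = nat \<lceil>norm \<zeta>\<rceil> + 1"
  define E where "E = {- int n..int n}"
  have n: "norm \<zeta> + 1 \<le> real n"
    unfolding n_def by linarith
  have le: "norm (interpolation_term \<zeta> k) \<le> norm \<zeta> * norm (sin \<zeta>) * norm (\<alpha> 0) * (1 / (of_int k)\<^sup>2)"
    if "k \<in> UNIV - {0} - E" for k
  proof -
    let ?p = "of_int k * of_real pi :: complex"
    have k: "real n < \<bar>real_of_int k\<bar>"
      using that unfolding E_def by auto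
    have norm_p: "norm ?p = \<bar>of_int k\<bar> * pi"
      by (simp add: norm_mult)
    have "2 * \<bar>real_of_int k\<bar> \<le> \<bar>of_int k\<bar> * pi"
      using mult_left_mono[OF pi_ge_two, of "\<bar>real_of_int k\<bar>"] by (simp add: mult.commute)
    then have far: "\<bar>of_int k\<bar> \<le> norm ?p" "\<bar>of_int k\<bar> \<le> norm (\<zeta> - ?p)"
      using k n norm_triangle_ineq2[of ?p \<zeta>] unfolding norm_p norm_minus_commute[of \<zeta>] by linarith+
    have pos: "0 < \<bar>real_of_int k\<bar>"
      using k by linarith
    then have ne: "\<zeta> \<noteq> ?p"
      using far by auto
    have "norm (cos ?p) = 1"
    proof -
      have "norm (cos ?p) ^ 2 = 1"
        using arg_cong[OF cos_int_pi_square[of k], of norm] by (simp add: norm_mult power2_eq_square)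
      then show ?thesis
        by (simp add: power2_eq_1_iff) (smt (verit) norm_ge_zero)
    qed
    then have "norm (interpolation_term \<zeta> k) = norm \<zeta> * norm (sin \<zeta>) * norm (\<alpha> 0) / (norm ?p * norm (\<zeta> - ?p))"
      unfolding interpolation_term_def csinc_div_pi_minus_int[OF ne]
      by (simp add: norm_scaleC norm_divide norm_mult)
    also have "\<dots> \<le> norm \<zeta> * norm (sin \<zeta>) * norm (\<alpha> 0) / (\<bar>of_int k\<bar> * \<bar>of_int k\<bar>)"
    proof (rule frac_le)
      show "\<bar>of_int k\<bar> * \<bar>of_int k\<bar> \<le> norm ?p * norm (\<zeta> - ?p)"
        by (intro mult_mono far) auto
      show "0 < \<bar>real_of_int k\<bar> * \<bar>of_int k\<bar>"
        using pos pos by (rule mult_pos_pos)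
    qed simp_all
    finally show ?thesis
      by (simp add: power2_eq_square)
  qed
  have "(\<lambda>k::int. norm \<zeta> * norm (sin \<zeta>) * norm (\<alpha> 0) * (1 / (of_int k)\<^sup>2)) summable_on (UNIV - {0} - E)"
    by (intro summable_on_cmult_right summable_on_subset_banach[OF summable_on_inverse_square_int]) auto
  then have "interpolation_term \<zeta> abs_summable_on (UNIV - {0} - E)"
    by (rule Infinite_Sum.abs_summable_on_comparison_test') (rule le)
  then have "interpolation_term \<zeta> summable_on (UNIV - {0} - E) \<union> (E - {0})"
    by (rule summable_on_Un_disjoint[OF abs_summable_summable summable_on_finite]) (auto simp: E_def)
  also have "(UNIV - {0} - E) \<union> (E - {0}) = UNIV - {0}"
    by auto
  finally show ?thesis .
qed

text \<open>The interpolation limit for \<open>quotient\<close>, multiplied by \<zeta> sin \<zeta>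
  to clear 1 / sin \<zeta> and the division by \<zeta> within \<open>quotient\<close>.\<close>

lemma flow_interpolation_aux:
  assumes "sin \<zeta> \<noteq> 0"
  shows "(\<lambda>N. sum (interpolation_term \<zeta>) ({- int N..int N} - {0}))
    \<longlonglongrightarrow> flow \<zeta> - (sin \<zeta> / \<zeta>) *\<^sub>C \<alpha> 0 - sin \<zeta> *\<^sub>C \<alpha> 1"
proof -
  let ?p = "\<lambda>k::int. of_int k * of_real pi :: complex"
  have \<zeta>: "\<zeta> \<noteq> 0"
    using assms by auto
  have ne: "\<zeta> \<noteq> ?p k" for k
    using assms by auto
  have "(\<lambda>N. \<Sum>k = - int N..int N. (cos (?p k) / (\<zeta> - ?p k)) *\<^sub>C quotient (?p k))
      \<longlonglongrightarrow> (1 / sin \<zeta>) *\<^sub>C quotient \<zeta>"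
    using symmetric_interpolation_tendsto[OF summable_quotient _ assms] quotient_growth
    unfolding quotient_def by blast
  then have "(\<lambda>N. (\<zeta> * sin \<zeta>) *\<^sub>C
        (\<Sum>k = - int N..int N. (cos (?p k) / (\<zeta> - ?p k)) *\<^sub>C quotient (?p k)) - sin \<zeta> *\<^sub>C \<alpha> 1)
      \<longlonglongrightarrow> (\<zeta> * sin \<zeta>) *\<^sub>C ((1 / sin \<zeta>) *\<^sub>C quotient \<zeta>) - sin \<zeta> *\<^sub>C \<alpha> 1"
    by (intro tendsto_diff tendsto_const bounded_linear.tendsto[OF scaleC.bounded_linear_right])
  also have "(\<zeta> * sin \<zeta>) *\<^sub>C ((1 / sin \<zeta>) *\<^sub>C quotient \<zeta>) = flow \<zeta> - (sin \<zeta> / \<zeta>) *\<^sub>C \<alpha> 0"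
    using assms \<zeta>
    by (simp add: quotient_eq scaleC.diff_right scaleC_scaleC scaleC_one power2_eq_square)
  also have "(\<lambda>N. (\<zeta> * sin \<zeta>) *\<^sub>C
        (\<Sum>k = - int N..int N. (cos (?p k) / (\<zeta> - ?p k)) *\<^sub>C quotient (?p k)) - sin \<zeta> *\<^sub>C \<alpha> 1)
      = (\<lambda>N. sum (interpolation_term \<zeta>) ({- int N..int N} - {0}))"
  proof
    fix N :: nat
    let ?q = "\<lambda>k. (\<zeta> * sin \<zeta>) *\<^sub>C ((cos (?p k) / (\<zeta> - ?p k)) *\<^sub>C quotient (?p k))"
    have "(\<zeta> * sin \<zeta>) *\<^sub>C (\<Sum>k = - int N..int N. (cos (?p k) / (\<zeta> - ?p k)) *\<^sub>C quotient (?p k))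
        = sum ?q {- int N..int N}"
      by (rule scaleC.sum_right)
    also have "\<dots> = ?q 0 + sum ?q ({- int N..int N} - {0})"
      by (rule sum.remove) auto
    \<comment> \<open>The node 0 contributes the derivative instead of a value of the group; it is
      split off and cancels the subtracted term.\<close>
    also have "?q 0 = sin \<zeta> *\<^sub>C \<alpha> 1"
      using \<zeta> by (simp add: quotient_0 scaleC_scaleC)
    also have "sum ?q ({- int N..int N} - {0}) = sum (interpolation_term \<zeta>) ({- int N..int N} - {0})"
      by (intro sum.cong refl)
         (simp add: quotient_int_pi interpolation_term_def csinc_div_pi_minus_int[OF ne]
           scaleC_scaleC mult_ac)
    finally show "(\<zeta> * sin \<zeta>) *\<^sub>C
        (\<Sum>k = - int N..int N. (cos (?p k) / (\<zeta> - ?p k)) *\<^sub>C quotient (?p k)) - sin \<zeta> *\<^sub>C \<alpha> 1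
      = sum (interpolation_term \<zeta>) ({- int N..int N} - {0})"
      by simp
  qed
  finally show ?thesis .
qed

lemma flow_interpolation:
  "flow \<zeta> = (\<zeta> * csinc (\<zeta> / of_real pi)) *\<^sub>C \<alpha> 1 + csinc (\<zeta> / of_real pi) *\<^sub>C \<alpha> 0
    + (\<Sum>\<^sub>\<infinity>k\<in>UNIV - {0}. interpolation_term \<zeta> k)"
proof (cases "sin \<zeta> = 0")
  case False
  then have \<zeta>: "\<zeta> \<noteq> 0"
    by auto
  have "(\<lambda>N. sum (interpolation_term \<zeta>) ({- int N..int N} - {0}))
      \<longlonglongrightarrow> (\<Sum>\<^sub>\<infinity>k\<in>UNIV - {0}. interpolation_term \<zeta> k)"
    using has_sum_infsum[OF interpolation_term_summable] unfolding has_sum_def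
    by (rule filterlim_compose[OF _ filterlim_symmetric_intervals])
  from LIMSEQ_unique[OF this flow_interpolation_aux[OF False]] \<zeta>
  show ?thesis
    by (simp add: csinc_div_pi)
next
  case True
  then obtain j :: int where "\<zeta> = of_real (of_int j * pi)"
    unfolding sin_eq_0 by blast
  then have j: "\<zeta> = of_int j * of_real pi"
    by simp
  \<comment> \<open>At the node j pi every other cardinal function vanishes, while the one of index
    \<open>j\<close> has the value \<open>csinc 0 = 1\<close>.\<close>
  have zero: "interpolation_term \<zeta> k = 0" if "k \<noteq> j" for k
  proof -
    have "\<zeta> \<noteq> of_int k * of_real pi"
      using that j by simp
    then show ?thesis
      by (simp add: interpolation_term_def csinc_div_pi_minus_int True scaleC.zero_left)
  qed
  show ?thesis
  proof (cases "j = 0")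
    case True
    have "(\<Sum>\<^sub>\<infinity>k\<in>UNIV - {0}. interpolation_term \<zeta> k) = 0"
      by (rule infsum_0) (use zero True in auto)
    then show ?thesis
      using True j flow_of_real[of 0] by (simp add: csinc_def scaleC_one scaleC.zero_left)
  next
    case False
    have "(\<Sum>\<^sub>\<infinity>k\<in>UNIV - {0}. interpolation_term \<zeta> k) = (\<Sum>\<^sub>\<infinity>k\<in>{j}. interpolation_term \<zeta> k)"
      by (rule infsum_cong_neutral) (use zero False in auto)
    also have "\<dots> = S (of_int j * pi) (\<alpha> 0)"
      using False by (simp add: interpolation_term_def j csinc_def scaleC_one)
    also have "\<dots> = flow \<zeta>"
      using flow_of_real[of "of_int j * pi"] j by simp
    finally show ?thesis
      using False j True by (simp only: csinc_div_pi) (simp add: scaleC.zero_left)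
  qed
qed

end

section \<open>From the group and its generator to the rescaled orbit\<close>

text \<open>The group law writes the increment at time \<open>s\<close> as \<open>T s\<close>
  applied to the increment at 0, and the bounded operator \<open>T s\<close> passes through the
  limit.\<close>

lemma orbit_has_vector_derivative:
  assumes group: "isometry_group T" and u: "u \<in> generator_domain T"
  shows "((\<lambda>t. T t u) has_vector_derivative T s (generator T u)) (at s)"
proof -
  have lin: "Vector_Spaces.linear (*\<^sub>C) (*\<^sub>C) (T s)" and iso: "norm (T s x) = norm x"
    and add: "T (s + h) x = T s (T h x)" for x h
    using group unfolding isometry_group_def by blast+
  interpret T: Vector_Spaces.linear "(*\<^sub>C)" "(*\<^sub>C)" "T s"
    by (rule lin)
  have scale: "T s (r *\<^sub>R x) = r *\<^sub>R T s x" for r x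
    using T.scale[of "complex_of_real r" x] by (simp add: scaleC_of_real)
  have blin: "bounded_linear (T s)"
    by (rule bounded_linear_intro[where K = 1]) (simp_all add: T.add scale iso)
  obtain g where "((\<lambda>t. (T t u - u) /\<^sub>R t) \<longlongrightarrow> g) (at 0)"
    using u by (auto simp: generator_domain_def)
  then have "((\<lambda>t. (T t u - u) /\<^sub>R t) \<longlongrightarrow> generator T u) (at 0)"
    unfolding generator_def by (simp add: tendsto_Lim)
  from bounded_linear.tendsto[OF blin this]
  have "((\<lambda>h. (T (s + h) u - T s u) /\<^sub>R h) \<longlongrightarrow> T s (generator T u)) (at 0)"
    by (simp add: add scale T.diff)
  then have "((\<lambda>h. norm ((T (s + h) u - T s u) /\<^sub>R h - T s (generator T u))) \<longlongrightarrow> 0) (at 0)"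
    by (intro tendsto_norm_zero) (simp add: LIM_zero_iff)
  moreover have "\<forall>\<^sub>F h in at 0. norm ((T (s + h) u - T s u) /\<^sub>R h - T s (generator T u))
      = norm (T (s + h) u - T s u - h *\<^sub>R T s (generator T u)) / norm h"
  proof (rule eventually_at_filter[THEN iffD2], intro always_eventually allI impI)
    fix h :: real
    assume "h \<noteq> 0"
    then have "(T (s + h) u - T s u) /\<^sub>R h - T s (generator T u)
        = (T (s + h) u - T s u - h *\<^sub>R T s (generator T u)) /\<^sub>R h"
      by (simp add: scaleR_diff_right)
    then show "norm ((T (s + h) u - T s u) /\<^sub>R h - T s (generator T u))
        = norm (T (s + h) u - T s u - h *\<^sub>R T s (generator T u)) / norm h"
      by (simp add: divide_inverse_commute)
  qed
  ultimately show ?thesis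
    unfolding has_vector_derivative_def has_derivative_at
    by (auto intro: bounded_linear_scaleR_left Lim_transform_eventually)
qed

text \<open>Slowing time down by \<sigma> yields a factor 1/\<sigma> for each derivative, which the
  coefficients absorb; the Bernstein inequality then bounds all of them by the norm of
  \<open>f\<close>.\<close>

lemma isometric_orbit_bernstein:
  assumes group: "isometry_group T" and "\<sigma> > 0"
    and f: "f \<in> bernstein_space (generator_domain T) (generator T) \<sigma>"
  shows "isometric_orbit (\<lambda>t. T (t / \<sigma>)) (\<lambda>n. (1 / \<sigma> ^ n) *\<^sub>R (generator T ^^ n) f) (norm f)"
proof (rule isometric_orbit.intro)
  let ?D = "generator T"
  fix t s :: real and x :: 'a and k n :: nat
  have lin: "Vector_Spaces.linear (*\<^sub>C) (*\<^sub>C) (T t)" for t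
    using group unfolding isometry_group_def by blast
  show "Vector_Spaces.linear (*\<^sub>C) (*\<^sub>C) (T (t / \<sigma>))"
    by (rule lin)
  show "norm (T (t / \<sigma>) x) = norm x" "T (0 / \<sigma>) x = x"
    using group unfolding isometry_group_def by simp_all
  have scale: "T t (r *\<^sub>R y) = r *\<^sub>R T t y" for t r y
  proof -
    interpret T: Vector_Spaces.linear "(*\<^sub>C)" "(*\<^sub>C)" "T t"
      by (rule lin)
    show ?thesis
      using T.scale[of "complex_of_real r" y] by (simp add: scaleC_of_real)
  qed
  have "f \<in> power_domain (generator_domain T) ?D (Suc k)"
    using f unfolding bernstein_space_def smooth_domain_def by blast
  then have "(?D ^^ k) f \<in> generator_domain T"
    by simp
  moreover have "((\<lambda>s. s / \<sigma>) has_vector_derivative 1 / \<sigma>) (at s)"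
    using bounded_linear.has_vector_derivative[OF bounded_linear_divide has_vector_derivative_id] .
  ultimately have "((\<lambda>s. T (s / \<sigma>) ((?D ^^ k) f)) has_vector_derivative
      (1 / \<sigma>) *\<^sub>R T (s / \<sigma>) ((?D ^^ Suc k) f)) (at s)"
    using vector_diff_chain_at orbit_has_vector_derivative[OF group] by (fastforce simp: o_def)
  from bounded_linear.has_vector_derivative[OF bounded_linear_scaleR_right[of "1 / \<sigma> ^ k"] this]
  show "((\<lambda>s. T (s / \<sigma>) ((1 / \<sigma> ^ k) *\<^sub>R (?D ^^ k) f)) has_vector_derivative
      T (s / \<sigma>) ((1 / \<sigma> ^ Suc k) *\<^sub>R (?D ^^ Suc k) f)) (at s)"
    by (simp add: scale mult.commute)
  \<comment> \<open>The Bernstein condition speaks of exponents from 1 on; exponent 0 is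
    trivial.\<close>
  have "norm ((?D ^^ n) f) \<le> \<sigma> ^ n * norm f"
    using f by (cases "n = 0") (auto simp: bernstein_space_def)
  then show "norm ((1 / \<sigma> ^ n) *\<^sub>R (?D ^^ n) f) \<le> norm f"
    using \<open>\<sigma> > 0\<close> by (simp add: field_simps)
qed

theorem theorem8p4:
  fixes T :: "real \<Rightarrow> 'a::complex_banach \<Rightarrow> 'a"
    and \<sigma> :: real and f :: 'a and z :: complex
  assumes "isometry_group T"
    and "\<sigma> > 0"
    and "f \<in> bernstein_space (generator_domain T) (generator T) \<sigma>"
  shows "(\<lambda>k::int. (of_real \<sigma> * z / (of_int k * of_real pi)
              * csinc (of_real \<sigma> * z / of_real pi - of_int k))
            *\<^sub>C T (of_int k * pi / \<sigma>) f) summable_on (UNIV - {0}) \<and>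
    exp_operator (generator T) z f =
        (z * csinc (of_real \<sigma> * z / of_real pi)) *\<^sub>C generator T f
      + csinc (of_real \<sigma> * z / of_real pi) *\<^sub>C f
      + (\<Sum>\<^sub>\<infinity>k::int\<in>UNIV - {0}. (of_real \<sigma> * z / (of_int k * of_real pi)
              * csinc (of_real \<sigma> * z / of_real pi - of_int k))
            *\<^sub>C T (of_int k * pi / \<sigma>) f)"
proof -
  let ?\<alpha> = "\<lambda>n. (1 / \<sigma> ^ n) *\<^sub>R (generator T ^^ n) f"
  interpret isometric_orbit "\<lambda>t. T (t / \<sigma>)" ?\<alpha> "norm f"
    by (rule isometric_orbit_bernstein[OF assms])
  \<comment> \<open>The powers of \<sigma> in (\<sigma> z)^n cancel those in the rescaled
    coefficients.\<close>
  have "exp_operator (generator T) z f = flow (of_real \<sigma> * z)"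
    using \<open>\<sigma> > 0\<close> unfolding exp_operator_def exp_series_def scaleC_of_real[symmetric]
    by (simp add: scaleC_scaleC power_mult_distrib)
  moreover have "(of_real \<sigma> * z * csinc (of_real \<sigma> * z / of_real pi)) *\<^sub>C ?\<alpha> 1
      = (z * csinc (of_real \<sigma> * z / of_real pi)) *\<^sub>C generator T f"
    using \<open>\<sigma> > 0\<close> unfolding scaleC_of_real[symmetric] by (simp add: scaleC_scaleC)
  ultimately show ?thesis
    using interpolation_term_summable[of "of_real \<sigma> * z"] flow_interpolation[of "of_real \<sigma> * z"]
    unfolding interpolation_term_def[abs_def] by simp
qed

end
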